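(* Let $X = AA_3\cdot BB_3$, the common point of the lines $AA_3, BB_3, CC_3$, where $A_3=T_P(D_3)$, $B_3=T_P(E_3)$, $C_3=T_P(F_3)$. The point $X$, which is a fixed point of $T_P\circ T_{P'}$, is the $P$-ceva conjugate of $Q$. The cevian triangle of $P$ (with respect to $ABC$) is homothetic to the anticevian triangle of $Q$ for triangle $ABC$ from the center $X$ if $X$ is an ordinary point, and is congruent to this triangle otherwise.
   Context: The plane is the real Euclidean plane extended by the line at infinity $l_\infty$; points not on $l_\infty$ are ordinary, points on it are infinite. Affine maps are extended to act on $l_\infty$. $XY$ denotes the line through $X,Y$, and $\ell\cdot m$ the intersection of lines $\ell,m$. $ABC$ is a nondegenerate triangle with ordinary vertices, its sides being full lines; $G$ is its centroid. The complement map $K$ is the affine map fixing $G$ and sending each ordinary $Y$ to the point $K(Y)$ with $\overrightarrow{GK(Y)}=-\tfrac12\overrightarrow{GY}$; it fixes every infinite point. The anticomplementary triangle is $K^{-1}(ABC)$. $P$ is a point (ordinary or infinite) not lying on the extended sides of $ABC$ or of its anticomplementary triangle. The cevian triangle $DEF$ of $P$ is given by $D=AP\cdot BC$, $E=BP\cdot AC$, $F=CP\cdot AB$. Let $D_3,E_3,F_3$ be the reflections of $D,E,F$ in the midpoints of $BC,AC,AB$ respectively; the lines $AD_3,BE_3,CF_3$ meet in the isotomic conjugate $P'=\iota(P)$ (possibly infinite), so $D_3E_3F_3$ is the cevian triangle of $P'$. The isotomcomplement of $P$ is $Q=K(P')$. $T_P$ and $T_{P'}$ are the affine maps taking $A,B,C$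 to $D,E,F$ and to $D_3,E_3,F_3$ respectively. The anticevian triangle of $Q$ with respect to $ABC$ is the triangle $A'B'C'$ whose cevian triangle for the point $Q$ is $ABC$ (i.e. $A=A'Q\cdot B'C'$, $B=B'Q\cdot A'C'$, $C=C'Q\cdot A'B'$). The $P$-ceva conjugate of $Q$ is the perspector (common point of lines joining corresponding vertices) of the cevian triangle of $P$ and the anticevian triangle of $Q$, both with respect to $ABC$. The lines $AA_3,BB_3,CC_3$ are known to be concurrent (ordinary or infinite common point). *)

theory Defs
  imports "HOL-Analysis.Analysis"
begin

type_synonym plane = "real ^ 2"

text \<open>A point at infinity is a parallel class of ordinary lines, represented by the common
  direction space (a one-dimensional subspace) of these lines.\<close>

typedef direction = "{span {v} | v :: plane. v \<noteq> 0}"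
  by (rule exI [of _ "span {axis 1 1}"]) (auto simp: axis_eq_0_iff intro!: exI [of _ "axis 1 1"])

definition dir :: "plane \<Rightarrow> direction" where
  "dir v = Abs_direction (span {v})"

datatype xpoint = Ordinary plane | Infinite direction

definition line_at_infinity :: "xpoint set" where
  "line_at_infinity = range Infinite"

definition ordinary_line :: "plane \<Rightarrow> plane \<Rightarrow> xpoint set" where
  "ordinary_line a v = insert (Infinite (dir v)) {Ordinary (a + t *\<^sub>R v) | t. True}"

definition xlines :: "xpoint set set" where
  "xlines = insert line_at_infinity {ordinary_line a v | a v. v \<noteq> 0}"

definition xcollinear :: "xpoint \<Rightarrow> xpoint \<Rightarrow> xpoint \<Rightarrow> bool" where
  "xcollinear X Y Z \<longleftrightarrow> (\<exists>l\<in>xlines. X \<in> l \<and> Y \<in> l \<and> Z \<in> l)"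

text \<open>Meaningful only for distinct points and distinct lines, respectively.\<close>

definition join :: "xpoint \<Rightarrow> xpoint \<Rightarrow> xpoint set" where
  "join X Y = (THE l. l \<in> xlines \<and> X \<in> l \<and> Y \<in> l)"

definition meet :: "xpoint set \<Rightarrow> xpoint set \<Rightarrow> xpoint" where
  "meet l m = (THE X. X \<in> l \<and> X \<in> m)"

definition common_point :: "xpoint set \<Rightarrow> xpoint set \<Rightarrow> xpoint set \<Rightarrow> xpoint" where
  "common_point l m n = (THE X. X \<in> l \<and> X \<in> m \<and> X \<in> n)"

definition affine_map :: "(plane \<Rightarrow> plane) \<Rightarrow> bool" where
  "affine_map f \<longleftrightarrow> (\<exists>L b. linear L \<and> f = (\<lambda>x. L x + b))"

text \<open>The extension of an (injective) affine map to the points at infinity, on which it acts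
  through its linear part \<open>\<lambda>v. f v - f 0\<close>.\<close>

fun extend_affine :: "(plane \<Rightarrow> plane) \<Rightarrow> xpoint \<Rightarrow> xpoint" where
  "extend_affine f (Ordinary x) = Ordinary (f x)"
| "extend_affine f (Infinite d) =
     Infinite (Abs_direction ((\<lambda>v. f v - f 0) ` Rep_direction d))"

definition point_reflection :: "plane \<Rightarrow> plane \<Rightarrow> plane" where
  "point_reflection m x = m - (x - m)"

definition homothety :: "plane \<Rightarrow> real \<Rightarrow> plane \<Rightarrow> plane" where
  "homothety c k x = c + k *\<^sub>R (x - c)"

definition centroid :: "plane \<Rightarrow> plane \<Rightarrow> plane \<Rightarrow> plane" where
  "centroid A B C = (1 / 3) *\<^sub>R (A + B + C)"

definition complement_map :: "plane \<Rightarrow> plane \<Rightarrow> plane \<Rightarrow> plane \<Rightarrow> plane" where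
  "complement_map A B C Y = centroid A B C - (1 / 2) *\<^sub>R (Y - centroid A B C)"

type_synonym xtriangle = "xpoint \<times> xpoint \<times> xpoint"

definition on_sides :: "xtriangle \<Rightarrow> xpoint \<Rightarrow> bool" where
  "on_sides = (\<lambda>(A, B, C) P. P \<in> join B C \<or> P \<in> join A C \<or> P \<in> join A B)"

definition ordinary_triangle :: "plane \<Rightarrow> plane \<Rightarrow> plane \<Rightarrow> xtriangle" where
  "ordinary_triangle A B C = (Ordinary A, Ordinary B, Ordinary C)"

definition anticomplementary_triangle :: "plane \<Rightarrow> plane \<Rightarrow> plane \<Rightarrow> xtriangle" where
  "anticomplementary_triangle A B C =
     (let K = complement_map A B C in ordinary_triangle (inv K A) (inv K B) (inv K C))"

definition cevian_triangle :: "xtriangle \<Rightarrow> xpoint \<Rightarrow> xtriangle" where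
  "cevian_triangle = (\<lambda>(A, B, C) P.
     (meet (join A P) (join B C), meet (join B P) (join A C), meet (join C P) (join A B)))"

text \<open>The anticevian triangle may a priori have vertices at infinity; it is required to be a
  genuine triangle of the projective plane.\<close>

definition anticevian_triangle :: "xtriangle \<Rightarrow> xpoint \<Rightarrow> xtriangle" where
  "anticevian_triangle T Q =
     (THE (A', B', C'). \<not> xcollinear A' B' C' \<and> cevian_triangle (A', B', C') Q = T)"

definition perspector :: "xtriangle \<Rightarrow> xtriangle \<Rightarrow> xpoint" where
  "perspector = (\<lambda>(A, B, C) (A', B', C'). common_point (join A A') (join B B') (join C C'))"

definition ceva_conjugate :: "xtriangle \<Rightarrow> xpoint \<Rightarrow> xpoint \<Rightarrow> xpoint" where
  "ceva_conjugate T P Q = perspector (cevian_triangle T P) (anticevian_triangle T Q)"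

definition triangle_map :: "plane \<Rightarrow> plane \<Rightarrow> plane \<Rightarrow> xtriangle \<Rightarrow> xpoint \<Rightarrow> xpoint" where
  "triangle_map A B C = (\<lambda>(D, E, F). THE T. (\<exists>f. affine_map f \<and> T = extend_affine f) \<and>
     T (Ordinary A) = D \<and> T (Ordinary B) = E \<and> T (Ordinary C) = F)"

text \<open>The triangle \<open>D\<^sub>3E\<^sub>3F\<^sub>3\<close>.\<close>

definition reflected_cevian_triangle ::
    "plane \<Rightarrow> plane \<Rightarrow> plane \<Rightarrow> xpoint \<Rightarrow> xtriangle" where
  "reflected_cevian_triangle A B C P =
     (case cevian_triangle (ordinary_triangle A B C) P of (D, E, F) \<Rightarrow>
       (extend_affine (point_reflection (midpoint B C)) D,
        extend_affine (point_reflection (midpoint A C)) E,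
        extend_affine (point_reflection (midpoint A B)) F))"

definition isotomic_conjugate :: "plane \<Rightarrow> plane \<Rightarrow> plane \<Rightarrow> xpoint \<Rightarrow> xpoint" where
  "isotomic_conjugate A B C P =
     perspector (ordinary_triangle A B C) (reflected_cevian_triangle A B C P)"

definition isotomcomplement :: "plane \<Rightarrow> plane \<Rightarrow> plane \<Rightarrow> xpoint \<Rightarrow> xpoint" where
  "isotomcomplement A B C P =
     extend_affine (complement_map A B C) (isotomic_conjugate A B C P)"

text \<open>Homothety and congruence respect the given correspondence of the vertices, which have
  to be ordinary.\<close>

definition homothetic_from :: "plane \<Rightarrow> xtriangle \<Rightarrow> xtriangle \<Rightarrow> bool" where
  "homothetic_from c S T \<longleftrightarrow> (\<exists>p q r k. k \<noteq> 0 \<and> S = ordinary_triangle p q r \<and>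
     T = ordinary_triangle (homothety c k p) (homothety c k q) (homothety c k r))"

definition congruent_triangles :: "xtriangle \<Rightarrow> xtriangle \<Rightarrow> bool" where
  "congruent_triangles S T \<longleftrightarrow>
     (\<exists>p q r g. (\<forall>u v. dist (g u) (g v) = dist u v) \<and> S = ordinary_triangle p q r \<and>
       T = ordinary_triangle (g p) (g q) (g r))"

end

theory Submission
  imports Defs
begin

text \<open>Everything is a computation in homogeneous barycentric coordinates with respect to \<open>ABC\<close>.
Every point of the extended plane has a nonzero coordinate vector in \<open>\<real>\<^sup>3\<close>, unique up to a
factor; a point is infinite exactly if its coordinates add up to \<open>0\<close>. Every line is the set of
points whose coordinates are orthogonal to some nonzero vector, so that joins and meets are cross
products (\<open>join_pt\<close>, \<open>meet_hline\<close>), and affine maps act linearly on the coordinates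
(\<open>extend_affine_pt\<close>), for ordinary and infinite points alike.

Let \<open>P = (x : y : z)\<close>. The two hypotheses on \<open>P\<close> say that \<open>x\<close>, \<open>y\<close>, \<open>z\<close> and \<open>y + z\<close>, \<open>z + x\<close>,
\<open>x + y\<close> are nonzero. Then \<open>D = (0 : y : z)\<close>, \<open>D\<^sub>3 = (0 : z : y)\<close>, \<open>P' = (yz : zx : xy)\<close> and
\<open>Q = (x(y + z) : y(z + x) : z(x + y))\<close>. The anticevian triangle of a point \<open>(u : v : w)\<close> off the sides is
\<open>(-u : v : w)\<close>, \<open>(u : -v : w)\<close>, \<open>(u : v : -w)\<close>; that these are the only possible vertices
(\<open>anticevian_vertices_unique\<close>) is the delicate point, because the defining joins and meets carry
no information in degenerate positions. The coordinates of \<open>A\<^sub>3\<close>, \<open>B\<^sub>3\<close>, \<open>C\<^sub>3\<close> are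
polynomials, and the three lines \<open>AA\<^sub>3\<close>, \<open>BB\<^sub>3\<close>, \<open>CC\<^sub>3\<close> concur in
\<open>X = (x\<^sup>2(y + z) : y\<^sup>2(z + x) : z\<^sup>2(x + y))\<close>.

The fixed point property holds because \<open>T\<^sub>P'\<close> takes \<open>X\<close> to \<open>(yz(y + z) : zx(z + x) : xy(x + y))\<close>,
which \<open>T\<^sub>P\<close> takes back to \<open>X\<close>. For the last claims, normalise coordinates to sum \<open>1\<close>. With
\<open>k = (x + y)(y + z)(z + x) / 2xyz\<close> and \<open>t = - 1 / 2xyz\<close> each vertex of the anticevian triangle of
\<open>Q\<close> is \<open>k\<close> times the corresponding vertex of the cevian triangle of \<open>P\<close> plus the fixed vector
\<open>t (x\<^sup>2(y + z), y\<^sup>2(z + x), z\<^sup>2(x + y))\<close> (\<open>anticevian_vertices_as_images\<close>). If \<open>X\<close> is ordinary, this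
is the homothety with centre \<open>X\<close> and ratio \<open>k\<close>; if \<open>X\<close> is infinite, the coordinates of \<open>X\<close> add up
to \<open>0\<close>, which forces \<open>k = 1\<close>, and it is a translation in the direction of \<open>X\<close>.\<close>

section \<open>Directions and vectors in three-space\<close>


unbundle cross3_syntax

lemma span_singleton_eq_iff:
  fixes v w :: "'a::real_vector"
  assumes "v \<noteq> 0" "w \<noteq> 0"
  shows "span {v} = span {w} \<longleftrightarrow> (\<exists>k. k \<noteq> 0 \<and> w = k *\<^sub>R v)"
proof
  assume "span {v} = span {w}"
  then have "w \<in> span {v}" by (simp add: span_base)
  then show "\<exists>k. k \<noteq> 0 \<and> w = k *\<^sub>R v" using assms(2) by (auto simp: span_singleton)
next
  assume "\<exists>k. k \<noteq> 0 \<and> w = k *\<^sub>R v"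
  then obtain k where k: "k \<noteq> 0" "w = k *\<^sub>R v" by blast
  have "span {w} \<subseteq> span {v}" using k by (simp add: span_minimal span_base span_scale)
  moreover have "v = (1/k) *\<^sub>R w" using k by simp
  then have "span {v} \<subseteq> span {w}" by (metis empty_subsetI insert_subset span_base span_minimal span_scale subspace_span singletonI)
  ultimately show "span {v} = span {w}" by blast
qed

lemma Rep_direction_dir: "v \<noteq> 0 \<Longrightarrow> Rep_direction (dir v) = span {v}"
  unfolding dir_def by (rule Abs_direction_inverse) blast

lemma dir_eq_iff:
  assumes "v \<noteq> 0" "w \<noteq> 0"
  shows "dir v = dir w \<longleftrightarrow> (\<exists>k. k \<noteq> 0 \<and> w = k *\<^sub>R v)"
  using assms by (metis Rep_direction_dir Rep_direction_inverse span_singleton_eq_iff)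

lemma direction_cases: obtains v where "v \<noteq> 0" "d = dir v"
  using Rep_direction[of d] Rep_direction_inverse[of d] unfolding dir_def by auto

text \<open>If the linear part annihilates a direction, the image of its line is the zero subspace,
which represents no direction. So every later evaluation of an extended map comes with a proof that
the image vector does not vanish.\<close>

lemma extend_affine_infinite:
  assumes "linear L" "v \<noteq> 0" "L v \<noteq> 0"
  shows "extend_affine (\<lambda>x. L x + b) (Infinite (dir v)) = Infinite (dir (L v))"
proof -
  have "(\<lambda>v. (L v + b) - (L 0 + b)) ` span {v} = span {L v}"
    unfolding linear_0[OF assms(1)] using linear_span_image[OF assms(1), of "{v}"] by simp
  then show ?thesis
    unfolding extend_affine.simps Rep_direction_dir[OF assms(2)] by (simp add: dir_def)
qed

lemma cross3_eq_zero_iff: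
  assumes "v \<noteq> 0"
  shows "v \<times> w = 0 \<longleftrightarrow> (\<exists>k. w = k *\<^sub>R v)"
  using assms by (auto simp: cross_eq_0 collinear_lemma intro: exI[of _ 0])

lemma vec3_eq_iff: "v = w \<longleftrightarrow> v$1 = w$1 \<and> v$2 = w$2 \<and> v$3 = w$3" for v w :: "real^3"
  by (simp add: vec_eq_iff forall_3)

lemma inner3: "v \<bullet> w = v$1 * w$1 + v$2 * w$2 + v$3 * w$3" for v w :: "real^3"
  by (simp add: inner_vec_def sum_3)

lemmas vec3_simps = vec3_eq_iff inner3 cross_components

text \<open>Cramer's rule without division: it recovers a vector from its triple products with three
others, which for a genuine triangle supplies the coordinates of a point with respect to it.\<close>

lemma cramer3:
  "(a \<bullet> (b \<times> c)) *\<^sub>R g = (g \<bullet> (b \<times> c)) *\<^sub>R a + (g \<bullet> (c \<times> a)) *\<^sub>R b + (g \<bullet> (a \<times> b)) *\<^sub>R c"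
  for a b c g :: "real^3"
  by (simp add: vec3_simps, algebra)

text \<open>In homogeneous coordinates: three points lie on a line iff their determinant vanishes.
If two of the vectors are independent, their cross product is the required normal vector. Otherwise
all three are multiples of one vector, and anything orthogonal to that vector works.\<close>

lemma orthogonal_triple_exists_iff:
  "(\<exists>n. n \<noteq> 0 \<and> n \<bullet> a = 0 \<and> n \<bullet> b = 0 \<and> n \<bullet> c = 0) \<longleftrightarrow> a \<bullet> (b \<times> c) = 0"
  for a b c :: "real^3"
proof
  assume "\<exists>n. n \<noteq> 0 \<and> n \<bullet> a = 0 \<and> n \<bullet> b = 0 \<and> n \<bullet> c = 0"
  then obtain n where n: "n \<noteq> 0" "n \<bullet> a = 0" "n \<bullet> b = 0" "n \<bullet> c = 0" by blast
  have "(a \<bullet> (b \<times> c)) * (n \<bullet> n) = n \<bullet> ((a \<bullet> (b \<times> c)) *\<^sub>R n)" by simp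
  also have "\<dots> = 0" by (subst cramer3) (simp add: inner_add_right n)
  finally show "a \<bullet> (b \<times> c) = 0" using n(1) by simp
next
  assume 0: "a \<bullet> (b \<times> c) = 0"
  consider "b \<times> c \<noteq> 0" | "b \<times> c = 0" "b = 0" | k where "b \<noteq> 0" "c = k *\<^sub>R b"
    using cross3_eq_zero_iff by blast
  then show "\<exists>n. n \<noteq> 0 \<and> n \<bullet> a = 0 \<and> n \<bullet> b = 0 \<and> n \<bullet> c = 0"
  proof cases
    case 1 then show ?thesis using 0 by (intro exI[of _ "b \<times> c"]) (auto simp: dot_cross_self inner_commute)
  next
    case 2
    consider "a \<times> c \<noteq> 0" | "a = 0" | k where "a \<noteq> 0" "c = k *\<^sub>R a"
      using cross3_eq_zero_iff by blast
    then show ?thesis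
    proof cases
      case 1 then show ?thesis using 2 by (intro exI[of _ "a \<times> c"]) (auto simp: dot_cross_self inner_commute)
    next
      case a: 2
      obtain n where "n \<noteq> 0" "orthogonal c n" using orthogonal_to_vector_exists[of c] by auto
      then show ?thesis using a 2 by (intro exI[of _ n]) (auto simp: orthogonal_def inner_commute)
    next
      case a: 3
      obtain n where "n \<noteq> 0" "orthogonal a n" using orthogonal_to_vector_exists[of a] by auto
      then show ?thesis using a 2 by (intro exI[of _ n]) (auto simp: orthogonal_def inner_commute)
    qed
  next
    case 3
    consider "a \<times> b \<noteq> 0" | j where "a = j *\<^sub>R b"
      using cross3_eq_zero_iff[of b a] 3(1) cross_skew[of a b] by auto
    then show ?thesis
    proof cases
      case 1 then show ?thesis using 3 by (intro exI[of _ "a \<times> b"]) (auto simp: dot_cross_self inner_commute)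
    next
      case a: 2
      obtain n where "n \<noteq> 0" "orthogonal b n" using orthogonal_to_vector_exists[of b] by auto
      then show ?thesis using a 3 by (intro exI[of _ n]) (auto simp: orthogonal_def inner_commute)
    qed
  qed
qed

section \<open>Homogeneous barycentric coordinates\<close>

definition mass :: "real^3 \<Rightarrow> real" where
  "mass v = v$1 + v$2 + v$3"

lemma mass_simps [simp]:
  "mass (v + w) = mass v + mass w" "mass (k *\<^sub>R v) = k * mass v" "mass 0 = 0"
  "mass (vector [x, y, z]) = x + y + z"
  by (simp_all add: mass_def algebra_simps)

locale reference_triangle =
  fixes A B C :: plane
  assumes noncollinear: "\<not> collinear {A, B, C}"
begin

definition weighted_sum :: "real^3 \<Rightarrow> plane" where
  "weighted_sum v = v$1 *\<^sub>R A + v$2 *\<^sub>R B + v$3 *\<^sub>R C"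

lemma weighted_sum_simps [simp]:
  "weighted_sum (v + w) = weighted_sum v + weighted_sum w"
  "weighted_sum (k *\<^sub>R v) = k *\<^sub>R weighted_sum v" "weighted_sum 0 = 0"
  "weighted_sum (vector [x, y, z]) = x *\<^sub>R A + y *\<^sub>R B + z *\<^sub>R C"
  by (simp_all add: weighted_sum_def algebra_simps)

lemma weighted_sum_eq:
  "weighted_sum v = mass v *\<^sub>R A + v$2 *\<^sub>R (B - A) + v$3 *\<^sub>R (C - A)"
  by (simp add: weighted_sum_def mass_def algebra_simps)

lemma edges_independent:
  assumes "s *\<^sub>R (B - A) + t *\<^sub>R (C - A) = 0"
  shows "s = 0 \<and> t = 0"
proof -
  have nc: "\<not> collinear {0, B - A, C - A}"
    using noncollinear collinear_3[of B A C] by (simp add: NO_MATCH_def insert_commute)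
  show ?thesis
  proof (rule ccontr)
    assume "\<not> (s = 0 \<and> t = 0)"
    then consider "s \<noteq> 0" | "t \<noteq> 0" by blast
    then show False
    proof cases
      case 1
      then have "B - A = (- t / s) *\<^sub>R (C - A)"
        using arg_cong[OF assms, of "\<lambda>x. (1/s) *\<^sub>R x"] by (simp add: algebra_simps add_eq_0_iff2)
      then show False using nc by (metis collinear_lemma insert_commute)
    next
      case 2
      then have "C - A = (- s / t) *\<^sub>R (B - A)"
        using arg_cong[OF assms, of "\<lambda>x. (1/t) *\<^sub>R x"] by (simp add: algebra_simps add_eq_0_iff)
      then show False using nc by (metis collinear_lemma)
    qed
  qed
qed

lemma edges_independent_set: "independent {B - A, C - A}" "B - A \<noteq> C - A"
proof -
  show ne: "B - A \<noteq> C - A" using edges_independent[of 1 "-1"] by auto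
  show "independent {B - A, C - A}"
    unfolding dependent_finite[OF finite.insertI[OF finite.insertI[OF finite.emptyI]]]
    using ne edges_independent by auto
qed

lemma edges_span: obtains y z where "x = y *\<^sub>R (B - A) + z *\<^sub>R (C - A)"
proof -
  have "x \<in> span {B - A, C - A}"
    using card_ge_dim_independent[of "{B - A, C - A}" UNIV] edges_independent_set by auto
  then obtain y where "x - y *\<^sub>R (B - A) \<in> span {C - A}" by (auto simp: span_insert)
  then obtain z where "x - y *\<^sub>R (B - A) = z *\<^sub>R (C - A)" by (auto simp: span_singleton)
  then show ?thesis using that[of y z] by (simp add: algebra_simps)
qed

text \<open>The pair of weighted sum and mass is a linear isomorphism from \<open>\<real>\<^sup>3\<close> onto plane times
\<open>\<real>\<close>, that is, onto homogeneous coordinates of the extended plane. This lemma and the next say so.\<close>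

lemma weights_unique:
  assumes "weighted_sum v = weighted_sum w" "mass v = mass w"
  shows "v = w"
proof -
  have "(v$2 - w$2) *\<^sub>R (B - A) + (v$3 - w$3) *\<^sub>R (C - A) = 0"
    using assms unfolding weighted_sum_eq by (simp add: algebra_simps)
  from edges_independent[OF this] assms(2) show ?thesis by (simp add: vec3_eq_iff mass_def)
qed

lemma weights_exist: obtains v where "weighted_sum v = x" "mass v = s"
proof -
  obtain y z where yz: "x - s *\<^sub>R A = y *\<^sub>R (B - A) + z *\<^sub>R (C - A)" by (rule edges_span)
  show ?thesis
  proof (rule that)
    show "weighted_sum (vector [s - y - z, y, z]) = x"
      using yz by (simp add: algebra_simps)
    show "mass (vector [s - y - z, y, z]) = s" by simp
  qed
qed

text \<open>The point with given homogeneous coordinates. The zero vector stands for no point, which is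
why the statements below carry assumptions of the form \<open>v \<noteq> 0\<close>.\<close>

definition pt :: "real^3 \<Rightarrow> xpoint" where
  "pt v = (if mass v = 0 then Infinite (dir (weighted_sum v))
           else Ordinary ((1 / mass v) *\<^sub>R weighted_sum v))"

lemma weighted_sum_nonzero: "v \<noteq> 0 \<Longrightarrow> mass v = 0 \<Longrightarrow> weighted_sum v \<noteq> 0"
  using weights_unique[of v 0] by auto

lemma pt_surj: obtains v where "v \<noteq> 0" "X = pt v"
proof (cases X)
  case (Ordinary x)
  obtain v where v: "weighted_sum v = x" "mass v = 1" by (rule weights_exist)
  then have "v \<noteq> 0" by auto
  then show ?thesis using that[of v] Ordinary v by (simp add: pt_def)
next
  case (Infinite d)
  obtain x where x: "x \<noteq> 0" "d = dir x" by (rule direction_cases)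
  obtain v where "weighted_sum v = x" "mass v = 0" by (rule weights_exist)
  moreover from this x have "v \<noteq> 0" by auto
  ultimately show ?thesis using that[of v] x Infinite by (simp add: pt_def)
qed

lemma pt_scale: assumes "k \<noteq> 0" "v \<noteq> 0" shows "pt (k *\<^sub>R v) = pt v"
proof (cases "mass v = 0")
  case True
  then have "weighted_sum v \<noteq> 0" using assms by (simp add: weighted_sum_nonzero)
  then have "dir (k *\<^sub>R weighted_sum v) = dir (weighted_sum v)"
    using assms by (intro dir_eq_iff[THEN iffD2, symmetric]) auto
  then show ?thesis using True by (simp add: pt_def)
next
  case False
  then show ?thesis using assms by (simp add: pt_def)
qed

lemma pt_eq_iff_scale:
  assumes "v \<noteq> 0" "w \<noteq> 0"
  shows "pt v = pt w \<longleftrightarrow> (\<exists>k. k \<noteq> 0 \<and> w = k *\<^sub>R v)"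
proof
  assume eq: "pt v = pt w"
  show "\<exists>k. k \<noteq> 0 \<and> w = k *\<^sub>R v"
  proof (cases "mass v = 0")
    case True
    with eq have w: "mass w = 0" by (auto simp: pt_def split: if_splits)
    have "dir (weighted_sum v) = dir (weighted_sum w)" using eq True w by (simp add: pt_def)
    then obtain k where "k \<noteq> 0" "weighted_sum w = k *\<^sub>R weighted_sum v"
      using dir_eq_iff weighted_sum_nonzero assms True w by blast
    then show ?thesis using weights_unique[of w "k *\<^sub>R v"] True w by auto
  next
    case False
    with eq have w: "mass w \<noteq> 0" by (auto simp: pt_def split: if_splits)
    have "(1 / mass v) *\<^sub>R weighted_sum v = (1 / mass w) *\<^sub>R weighted_sum w"
      using eq False w by (simp add: pt_def)
    then have "weighted_sum w = weighted_sum ((mass w / mass v) *\<^sub>R v)" using w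
      by (metis (no_types, lifting) divide_inverse mult.commute mult_1 right_inverse scaleR_one scaleR_scaleR weighted_sum_simps(2))
    then show ?thesis using weights_unique[of w "(mass w / mass v) *\<^sub>R v"] False w
      by (intro exI[of _ "mass w / mass v"]) auto
  qed
qed (use assms pt_scale in auto)

lemma pt_eq_iff:
  assumes "v \<noteq> 0" "w \<noteq> 0"
  shows "pt v = pt w \<longleftrightarrow> v \<times> w = 0"
  using assms cross3_eq_zero_iff[OF assms(1), of w] by (auto simp: pt_eq_iff_scale)

section \<open>Lines, joins and meets as cross products\<close>

definition hline :: "real^3 \<Rightarrow> xpoint set" where
  "hline n = {pt v | v. v \<noteq> 0 \<and> n \<bullet> v = 0}"

lemma pt_in_hline: "v \<noteq> 0 \<Longrightarrow> pt v \<in> hline n \<longleftrightarrow> n \<bullet> v = 0"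
  unfolding hline_def by (auto simp: pt_eq_iff_scale)

lemma hline_scale: "k \<noteq> 0 \<Longrightarrow> hline (k *\<^sub>R n) = hline n"
  by (simp add: hline_def)

lemma hline_ones: "hline (vector [1, 1, 1]) = line_at_infinity"
proof -
  have "X \<in> hline (vector [1, 1, 1]) \<longleftrightarrow> X \<in> line_at_infinity" for X
  proof -
    obtain v where v: "v \<noteq> 0" "X = pt v" by (rule pt_surj)
    show ?thesis unfolding v(2) pt_in_hline[OF v(1)]
      by (auto simp: line_at_infinity_def pt_def inner3 mass_def)
  qed
  then show ?thesis by blast
qed

text \<open>A vector orthogonal to \<open>u \<times> w\<close> is a combination of \<open>u\<close> and \<open>w\<close> by Cramer's rule. If the
coefficient of \<open>u\<close> vanishes, it represents the direction of \<open>w\<close>; otherwise scaling this coefficient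
to \<open>1\<close> gives the parametrisation of the ordinary line.\<close>

lemma ordinary_line_eq_hline:
  assumes u: "mass u = 1" and w: "mass w = 0" "w \<noteq> 0"
  shows "ordinary_line (weighted_sum u) (weighted_sum w) = hline (u \<times> w)" "u \<times> w \<noteq> 0"
proof -
  show nz: "u \<times> w \<noteq> 0"
  proof
    assume "u \<times> w = 0"
    then have "w \<times> u = 0" using cross_skew[of w u] by simp
    then show False using cross3_eq_zero_iff[of w u] u w by auto
  qed
  show "ordinary_line (weighted_sum u) (weighted_sum w) = hline (u \<times> w)"
  proof (intro subset_antisym subsetI)
    fix X assume "X \<in> ordinary_line (weighted_sum u) (weighted_sum w)"
    then consider "X = Infinite (dir (weighted_sum w))"
      | t where "X = Ordinary (weighted_sum u + t *\<^sub>R weighted_sum w)"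
      unfolding ordinary_line_def by blast
    then show "X \<in> hline (u \<times> w)"
    proof cases
      case 1
      then have "X = pt w" using w by (simp add: pt_def)
      then show ?thesis using w by (simp add: pt_in_hline dot_cross_self)
    next
      case 2
      then have "X = pt (u + t *\<^sub>R w)" using u w by (simp add: pt_def)
      moreover have "u + t *\<^sub>R w \<noteq> 0" using u w by (metis add_0_right mass_simps(1-3) mult_zero_right zero_neq_one)
      ultimately show ?thesis
        by (simp add: pt_in_hline inner_add_right dot_cross_self inner_commute)
    qed
  next
    fix X assume "X \<in> hline (u \<times> w)"
    then obtain z where z: "z \<noteq> 0" "X = pt z" "(u \<times> w) \<bullet> z = 0" unfolding hline_def by blast
    let ?n = "u \<times> w"
    have "(?n \<bullet> ?n) *\<^sub>R z = (z \<bullet> (w \<times> ?n)) *\<^sub>R u + (z \<bullet> (?n \<times> u)) *\<^sub>R w"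
      using cramer3[of u w ?n z] z(3) cross_triple[of w ?n u] cross_triple[of u w ?n]
      by (simp add: inner_commute)
    then have "z = (1 / (?n \<bullet> ?n)) *\<^sub>R ((z \<bullet> (w \<times> ?n)) *\<^sub>R u + (z \<bullet> (?n \<times> u)) *\<^sub>R w)"
      using nz by (metis divide_self_if inner_eq_zero_iff scaleR_one scaleR_scaleR times_divide_eq_left mult_1)
    then obtain s t where st: "z = s *\<^sub>R u + t *\<^sub>R w" by (metis scaleR_add_right scaleR_scaleR)
    show "X \<in> ordinary_line (weighted_sum u) (weighted_sum w)"
    proof (cases "s = 0")
      case True
      then have "X = pt w" using st z by (auto simp: pt_scale w)
      then show ?thesis using w by (simp add: pt_def ordinary_line_def)
    next
      case False
      then have "X = Ordinary (weighted_sum u + (t / s) *\<^sub>R weighted_sum w)"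
        unfolding z(2) st using u w by (simp add: pt_def scaleR_add_right)
      then show ?thesis by (auto simp: ordinary_line_def)
    qed
  qed
qed

text \<open>Every line of the extended plane has an equation, and conversely. For the converse a
normal vector \<open>n\<close> not proportional to \<open>(1, 1, 1)\<close> gives the direction \<open>w = n \<times> (1, 1, 1)\<close> of its line,
the intersection with the line at infinity, and the ordinary point \<open>n \<times> w\<close> on it.\<close>

lemma xlines_eq: "xlines = {hline n | n. n \<noteq> 0}"
proof (intro subset_antisym subsetI)
  fix l assume "l \<in> xlines"
  then consider "l = line_at_infinity" | a v where "v \<noteq> 0" "l = ordinary_line a v"
    unfolding xlines_def by blast
  then show "l \<in> {hline n | n. n \<noteq> 0}"
  proof cases
    case 1
    moreover have "vector [1, 1, 1] \<noteq> (0 :: real^3)" by (simp add: vec3_eq_iff)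
    ultimately show ?thesis using hline_ones by auto
  next
    case 2
    obtain u where u: "weighted_sum u = a" "mass u = 1" by (rule weights_exist)
    obtain w where w: "weighted_sum w = v" "mass w = 0" by (rule weights_exist)
    then have "w \<noteq> 0" using 2 by auto
    then show ?thesis using ordinary_line_eq_hline[of u w] u w 2 by auto
  qed
next
  fix l assume "l \<in> {hline n | n. n \<noteq> 0}"
  then obtain n where n: "n \<noteq> 0" "l = hline n" by blast
  let ?e = "vector [1, 1, 1] :: real^3"
  have e: "?e \<noteq> 0" by (simp add: vec3_eq_iff)
  define w where "w = n \<times> ?e"
  define u where "u = n \<times> w"
  show "l \<in> xlines"
  proof (cases "w = 0")
    case True
    then obtain k where "?e = k *\<^sub>R n" using cross3_eq_zero_iff[OF n(1)] w_def by auto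
    moreover then have "k \<noteq> 0" using e by auto
    ultimately have "l = line_at_infinity" using hline_scale n hline_ones by metis
    then show ?thesis by (simp add: xlines_def)
  next
    case False
    have mw: "mass w = 0" by (simp add: w_def mass_def cross_components)
    have "mass u = - (w \<bullet> w)"
      unfolding u_def w_def by (simp add: mass_def vec3_simps algebra_simps)
    with False have mu: "mass u \<noteq> 0" by simp
    have "u \<times> w = - (w \<bullet> w) *\<^sub>R n"
      unfolding u_def w_def by (simp add: vec3_simps, algebra)
    then have "((1 / mass u) *\<^sub>R u) \<times> w = (- (w \<bullet> w) / mass u) *\<^sub>R n"
      by (simp add: cross_mult_left)
    then have "hline (((1 / mass u) *\<^sub>R u) \<times> w) = l"
      using n False mu hline_scale[of "- (w \<bullet> w) / mass u" n] by simp
    moreover have "ordinary_line (weighted_sum ((1 / mass u) *\<^sub>R u)) (weighted_sum w) =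
      hline (((1 / mass u) *\<^sub>R u) \<times> w)"
      using mu mw False by (intro ordinary_line_eq_hline) auto
    ultimately show ?thesis using weighted_sum_nonzero[OF False mw] unfolding xlines_def by blast
  qed
qed

lemma join_pt:
  assumes "v \<times> w \<noteq> 0"
  shows "join (pt v) (pt w) = hline (v \<times> w)"
proof -
  have nz: "v \<noteq> 0" "w \<noteq> 0" using assms by auto
  show ?thesis unfolding join_def
  proof (rule the_equality)
    show "hline (v \<times> w) \<in> xlines \<and> pt v \<in> hline (v \<times> w) \<and> pt w \<in> hline (v \<times> w)"
      using assms nz unfolding xlines_eq by (auto simp: pt_in_hline dot_cross_self)
  next
    fix l assume l: "l \<in> xlines \<and> pt v \<in> l \<and> pt w \<in> l"
    then obtain n where n: "n \<noteq> 0" "l = hline n" unfolding xlines_eq by blast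
    with l nz have "n \<bullet> v = 0" "n \<bullet> w = 0" by (auto simp: pt_in_hline)
    then have "n \<times> (v \<times> w) = 0" by (simp add: Lagrange)
    then obtain k where "v \<times> w = k *\<^sub>R n" using cross3_eq_zero_iff[OF n(1)] by blast
    moreover then have "k \<noteq> 0" using assms by auto
    ultimately show "l = hline (v \<times> w)" using n by (simp add: hline_scale)
  qed
qed

lemma in_two_hlines:
  assumes "m \<times> n \<noteq> 0"
  shows "X \<in> hline m \<and> X \<in> hline n \<longleftrightarrow> X = pt (m \<times> n)"
proof -
  obtain v where v: "v \<noteq> 0" "X = pt v" by (rule pt_surj)
  have "m \<bullet> v = 0 \<and> n \<bullet> v = 0 \<longleftrightarrow> v \<times> (m \<times> n) = 0"
  proof
    assume "m \<bullet> v = 0 \<and> n \<bullet> v = 0"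
    then show "v \<times> (m \<times> n) = 0" by (simp add: Lagrange inner_commute)
  next
    assume "v \<times> (m \<times> n) = 0"
    then obtain k where k: "m \<times> n = k *\<^sub>R v" using cross3_eq_zero_iff[OF v(1)] by blast
    with assms have "k \<noteq> 0" by auto
    moreover have "k * (m \<bullet> v) = 0" "k * (n \<bullet> v) = 0"
      using dot_cross_self(1)[of m n] dot_cross_self(2)[of n m] unfolding k by auto
    ultimately show "m \<bullet> v = 0 \<and> n \<bullet> v = 0" by simp
  qed
  then show ?thesis using v assms by (simp add: pt_in_hline pt_eq_iff)
qed

lemma meet_hline:
  assumes "m \<times> n \<noteq> 0"
  shows "meet (hline m) (hline n) = pt (m \<times> n)"
  unfolding meet_def in_two_hlines[OF assms] by simp

lemma common_point_hline:
  assumes "m \<times> n \<noteq> 0" "v \<noteq> 0" "m \<bullet> v = 0" "n \<bullet> v = 0" "l \<bullet> v = 0"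
  shows "common_point (hline m) (hline n) (hline l) = pt v"
proof -
  have "pt v = pt (m \<times> n)" using in_two_hlines[OF assms(1), of "pt v"] assms by (simp add: pt_in_hline)
  moreover have "pt v \<in> hline l" using assms by (simp add: pt_in_hline)
  ultimately have "X \<in> hline m \<and> X \<in> hline n \<and> X \<in> hline l \<longleftrightarrow> X = pt v" for X
    using in_two_hlines[OF assms(1), of X] by auto
  then show ?thesis unfolding common_point_def by simp
qed

lemma xcollinear_pt:
  assumes "a \<noteq> 0" "b \<noteq> 0" "c \<noteq> 0"
  shows "xcollinear (pt a) (pt b) (pt c) \<longleftrightarrow> a \<bullet> (b \<times> c) = 0"
  unfolding xcollinear_def xlines_eq orthogonal_triple_exists_iff[symmetric]
  using assms by (auto simp: pt_in_hline)

lemma vertices_pt: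
  "Ordinary A = pt (vector [1, 0, 0])" "Ordinary B = pt (vector [0, 1, 0])"
  "Ordinary C = pt (vector [0, 0, 1])"
  by (simp_all add: pt_def)

lemma pt_eqI: "k \<noteq> 0 \<Longrightarrow> v \<noteq> 0 \<Longrightarrow> w = k *\<^sub>R v \<Longrightarrow> pt w = pt v"
  using pt_scale by simp

lemma join_pt_eq: "n \<noteq> 0 \<Longrightarrow> v \<times> w = n \<Longrightarrow> join (pt v) (pt w) = hline n"
  using join_pt by simp

section \<open>Affine maps in coordinates\<close>

text \<open>Homogeneous coordinates linearise an affine map: it keeps the mass and acts on weighted sums
by a linear formula, which covers ordinary and infinite points at once.\<close>

lemma extend_affine_pt:
  assumes "linear L" "v \<noteq> 0" "w \<noteq> 0" "mass w = mass v"
    and "weighted_sum w = L (weighted_sum v) + mass v *\<^sub>R b"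
  shows "extend_affine (\<lambda>x. L x + b) (pt v) = pt w"
proof (cases "mass v = 0")
  case True
  then have "weighted_sum v \<noteq> 0" "L (weighted_sum v) \<noteq> 0"
    using weighted_sum_nonzero[of v] weighted_sum_nonzero[of w] assms by auto
  then show ?thesis using True assms
    by (simp add: pt_def extend_affine_infinite del: extend_affine.simps)
next
  case False
  then show ?thesis using assms by (simp add: pt_def linear_scale scaleR_add_right)
qed

lemma affine_map_eqI:
  assumes "affine_map f" "affine_map g" "f A = g A" "f B = g B" "f C = g C"
  shows "f = g"
proof
  fix x
  obtain L b where L: "linear L" "f = (\<lambda>x. L x + b)" using assms(1) unfolding affine_map_def by blast
  obtain M c where M: "linear M" "g = (\<lambda>x. M x + c)" using assms(2) unfolding affine_map_def by blast
  obtain y z where "x - A = y *\<^sub>R (B - A) + z *\<^sub>R (C - A)" by (rule edges_span)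
  then have x: "x = A + y *\<^sub>R (B - A) + z *\<^sub>R (C - A)" by (simp add: algebra_simps)
  have "f x = f A + y *\<^sub>R (f B - f A) + z *\<^sub>R (f C - f A)"
    unfolding L(2) by (subst x) (simp add: linear_add linear_diff linear_scale L(1))
  moreover have "g x = g A + y *\<^sub>R (g B - g A) + z *\<^sub>R (g C - g A)"
    unfolding M(2) by (subst x) (simp add: linear_add linear_diff linear_scale M(1))
  ultimately show "f x = g x" using assms by simp
qed

lemma affine_map_exists:
  obtains L b where "linear L" "L A + b = x" "L B + b = y" "L C + b = z"
proof -
  define h where "h = (\<lambda>v. if v = B - A then y - x else z - x)"
  obtain L where L: "linear L" "\<forall>v\<in>{B - A, C - A}. L v = h v"
    using linear_independent_extend[OF edges_independent_set(1), of h] by blast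
  have "L (B - A) = y - x" "L (C - A) = z - x"
    using L(2) edges_independent_set(2) by (auto simp: h_def)
  then show ?thesis using that[of L "x - L A"] L(1) by (simp add: linear_diff algebra_simps)
qed

text \<open>Normalised coordinates of an image are obtained by substituting normalised vertices for
\<open>A\<close>, \<open>B\<close>, \<open>C\<close>. The common factor \<open>k\<close> and the coefficients \<open>\<alpha>\<close>, \<open>\<beta>\<close>, \<open>\<gamma>\<close> let applications state
this with polynomials only, clearing the denominators that the normalisation introduces.\<close>

lemma triangle_map_pt:
  assumes "mass d \<noteq> 0" "mass e \<noteq> 0" "mass f \<noteq> 0"
    and "v \<noteq> 0" "w \<noteq> 0" and k: "k \<noteq> 0"
    and coeffs: "\<alpha> * mass d = k * v$1" "\<beta> * mass e = k * v$2" "\<gamma> * mass f = k * v$3"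
    and w: "w = \<alpha> *\<^sub>R d + \<beta> *\<^sub>R e + \<gamma> *\<^sub>R f"
  shows "triangle_map A B C (pt d, pt e, pt f) (pt v) = pt w"
proof -
  define p where "p = (1 / mass d) *\<^sub>R weighted_sum d"
  define q where "q = (1 / mass e) *\<^sub>R weighted_sum e"
  define r where "r = (1 / mass f) *\<^sub>R weighted_sum f"
  have pt: "pt d = Ordinary p" "pt e = Ordinary q" "pt f = Ordinary r"
    using assms by (simp_all add: pt_def p_def q_def r_def)
  obtain L b where L: "linear L" "L A + b = p" "L B + b = q" "L C + b = r"
    by (rule affine_map_exists)
  have aff: "affine_map (\<lambda>x. L x + b)" unfolding affine_map_def using L(1) by blast
  have "triangle_map A B C (pt d, pt e, pt f) = extend_affine (\<lambda>x. L x + b)"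
    unfolding triangle_map_def pt split_conv
  proof (rule the_equality)
    show "(\<exists>g. affine_map g \<and> extend_affine (\<lambda>x. L x + b) = extend_affine g) \<and>
      extend_affine (\<lambda>x. L x + b) (Ordinary A) = Ordinary p \<and>
      extend_affine (\<lambda>x. L x + b) (Ordinary B) = Ordinary q \<and>
      extend_affine (\<lambda>x. L x + b) (Ordinary C) = Ordinary r"
      using aff L by auto
  next
    fix T assume "(\<exists>g. affine_map g \<and> T = extend_affine g) \<and>
      T (Ordinary A) = Ordinary p \<and> T (Ordinary B) = Ordinary q \<and> T (Ordinary C) = Ordinary r"
    then obtain g where "affine_map g" "T = extend_affine g" "g A = p" "g B = q" "g C = r" by auto
    then show "T = extend_affine (\<lambda>x. L x + b)" using affine_map_eqI[OF _ aff] L by auto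
  qed
  moreover have "extend_affine (\<lambda>x. L x + b) (pt v) = pt ((1 / k) *\<^sub>R w)"
  proof (rule extend_affine_pt)
    have "mass w = k * mass v" by (simp add: w coeffs) (simp add: mass_def algebra_simps)
    then show "mass ((1 / k) *\<^sub>R w) = mass v" using k by simp
    have "weighted_sum d = mass d *\<^sub>R p" "weighted_sum e = mass e *\<^sub>R q" "weighted_sum f = mass f *\<^sub>R r"
      using assms(1-3) by (simp_all add: p_def q_def r_def)
    then have "weighted_sum w = k *\<^sub>R (v$1 *\<^sub>R p + v$2 *\<^sub>R q + v$3 *\<^sub>R r)"
      by (simp add: w coeffs scaleR_add_right)
    moreover have "v$1 *\<^sub>R p + v$2 *\<^sub>R q + v$3 *\<^sub>R r = L (weighted_sum v) + mass v *\<^sub>R b"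
      unfolding L(2-4)[symmetric]
      by (simp add: weighted_sum_def mass_def linear_add linear_scale L(1) algebra_simps)
    ultimately show "weighted_sum ((1 / k) *\<^sub>R w) = L (weighted_sum v) + mass v *\<^sub>R b"
      using k by simp
  qed (use assms L in auto)
  ultimately show ?thesis using assms by (simp add: pt_scale)
qed

section \<open>Cevian and anticevian triangles\<close>

text \<open>The foot of the cevian through \<open>a\<close> is the combination of \<open>g\<close> and \<open>a\<close> that is orthogonal to
the side \<open>b \<times> c\<close>. It is nonzero as soon as the cevian is a line.\<close>

lemma cevian_vertex:
  assumes "a \<bullet> (b \<times> c) \<noteq> 0" "a \<times> g \<noteq> 0"
  shows "meet (join (pt a) (pt g)) (join (pt b) (pt c)) =
      pt ((a \<bullet> (b \<times> c)) *\<^sub>R g - (g \<bullet> (b \<times> c)) *\<^sub>R a)"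
    and "(a \<bullet> (b \<times> c)) *\<^sub>R g - (g \<bullet> (b \<times> c)) *\<^sub>R a \<noteq> 0"
proof -
  have eq: "(a \<times> g) \<times> (b \<times> c) = (a \<bullet> (b \<times> c)) *\<^sub>R g - (g \<bullet> (b \<times> c)) *\<^sub>R a"
    using Lagrange[of "b \<times> c" a g] cross_skew[of "a \<times> g" "b \<times> c"] by (simp add: inner_commute)
  show nz: "(a \<bullet> (b \<times> c)) *\<^sub>R g - (g \<bullet> (b \<times> c)) *\<^sub>R a \<noteq> 0"
  proof
    assume "(a \<bullet> (b \<times> c)) *\<^sub>R g - (g \<bullet> (b \<times> c)) *\<^sub>R a = 0"
    then have "a \<times> ((a \<bullet> (b \<times> c)) *\<^sub>R g - (g \<bullet> (b \<times> c)) *\<^sub>R a) = 0" by simp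
    then have "(a \<bullet> (b \<times> c)) *\<^sub>R (a \<times> g) = 0"
      by (simp add: Cross3.right_diff_distrib cross_mult_right)
    then show False using assms by simp
  qed
  have "b \<times> c \<noteq> 0" using assms(1) by auto
  then show "meet (join (pt a) (pt g)) (join (pt b) (pt c)) =
      pt ((a \<bullet> (b \<times> c)) *\<^sub>R g - (g \<bullet> (b \<times> c)) *\<^sub>R a)"
    using assms nz by (simp add: join_pt meet_hline eq)
qed

lemma cevian_triangle_pt:
  assumes d: "d = a \<bullet> (b \<times> c)" "d \<noteq> 0" and "a \<times> g \<noteq> 0" "b \<times> g \<noteq> 0" "c \<times> g \<noteq> 0"
  shows "cevian_triangle (pt a, pt b, pt c) (pt g) =
      (pt (d *\<^sub>R g - (g \<bullet> (b \<times> c)) *\<^sub>R a), pt (d *\<^sub>R g - (g \<bullet> (c \<times> a)) *\<^sub>R b),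
       pt (d *\<^sub>R g - (g \<bullet> (a \<times> b)) *\<^sub>R c))"
    and "d *\<^sub>R g - (g \<bullet> (b \<times> c)) *\<^sub>R a \<noteq> 0"
    and "d *\<^sub>R g - (g \<bullet> (c \<times> a)) *\<^sub>R b \<noteq> 0"
    and "d *\<^sub>R g - (g \<bullet> (a \<times> b)) *\<^sub>R c \<noteq> 0"
proof -
  have da: "a \<bullet> (b \<times> c) = d" using d by simp
  have db: "b \<bullet> (a \<times> c) = - d" unfolding d by (simp add: vec3_simps algebra_simps)
  have dc: "c \<bullet> (a \<times> b) = d" unfolding d by (simp add: vec3_simps algebra_simps)
  have ca: "g \<bullet> (a \<times> c) = - (g \<bullet> (c \<times> a))" by (simp add: vec3_simps algebra_simps)
  have b: "b \<bullet> (a \<times> c) \<noteq> 0" using db d by simp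
  note A = cevian_vertex[of a b c g, unfolded da, OF d(2) assms(3)]
  note B = cevian_vertex[of b a c g, OF b assms(4), unfolded db ca]
  note C = cevian_vertex[of c a b g, unfolded dc, OF d(2) assms(5)]
  show nz: "d *\<^sub>R g - (g \<bullet> (b \<times> c)) *\<^sub>R a \<noteq> 0" "d *\<^sub>R g - (g \<bullet> (c \<times> a)) *\<^sub>R b \<noteq> 0"
    "d *\<^sub>R g - (g \<bullet> (a \<times> b)) *\<^sub>R c \<noteq> 0"
    using A(2) B(2) C(2) by auto
  \<comment> \<open>The second cevian is listed against the side \<open>A'C'\<close> instead of \<open>C'A'\<close>, which costs a sign.\<close>
  have "pt (- d *\<^sub>R g - - (g \<bullet> (c \<times> a)) *\<^sub>R b) = pt (d *\<^sub>R g - (g \<bullet> (c \<times> a)) *\<^sub>R b)"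
    using nz by (intro pt_eqI[of "-1"]) auto
  then show "cevian_triangle (pt a, pt b, pt c) (pt g) =
      (pt (d *\<^sub>R g - (g \<bullet> (b \<times> c)) *\<^sub>R a), pt (d *\<^sub>R g - (g \<bullet> (c \<times> a)) *\<^sub>R b),
       pt (d *\<^sub>R g - (g \<bullet> (a \<times> b)) *\<^sub>R c))"
    unfolding cevian_triangle_def split_conv A(1) B(1) C(1) by simp
qed

lemma cevian_triangle_reference:
  assumes "x \<noteq> 0" "y \<noteq> 0" "z \<noteq> 0"
  shows "cevian_triangle (ordinary_triangle A B C) (pt (vector [x, y, z])) =
    (pt (vector [0, y, z]), pt (vector [x, 0, z]), pt (vector [x, y, 0]))"
proof -
  let ?a = "vector [1, 0, 0] :: real^3" and ?b = "vector [0, 1, 0] :: real^3"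
  let ?c = "vector [0, 0, 1] :: real^3" and ?g = "vector [x, y, z] :: real^3"
  have d: "1 = ?a \<bullet> (?b \<times> ?c)" by (simp add: vec3_simps)
  have nz: "?a \<times> ?g \<noteq> 0" "?b \<times> ?g \<noteq> 0" "?c \<times> ?g \<noteq> 0" using assms by (simp_all add: vec3_simps)
  have w: "1 *\<^sub>R ?g - (?g \<bullet> (?b \<times> ?c)) *\<^sub>R ?a = vector [0, y, z]"
    "1 *\<^sub>R ?g - (?g \<bullet> (?c \<times> ?a)) *\<^sub>R ?b = vector [x, 0, z]"
    "1 *\<^sub>R ?g - (?g \<bullet> (?a \<times> ?b)) *\<^sub>R ?c = vector [x, y, 0]"
    by (simp_all add: vec3_simps)
  show ?thesis
    using cevian_triangle_pt(1)[OF d _ nz] unfolding w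
    by (simp add: ordinary_triangle_def vertices_pt)
qed

text \<open>No vertex coincides with the given point \<open>g = (x, y, z)\<close>: if, say, \<open>A' = g\<close>,
then the cevian of \<open>B'\<close> is the side \<open>B'A'\<close>, it meets \<open>A'C'\<close> in \<open>A'\<close>, and hence \<open>g = A' = B\<close>, although
\<open>g\<close> is on no side of \<open>ABC\<close>. So all cevians are lines. With \<open>d\<close> the determinant of \<open>a\<close>, \<open>b\<close>, \<open>c\<close> and
\<open>d g = \<alpha> a + \<beta> b + \<gamma> c\<close>, the feet being \<open>A\<close>, \<open>B\<close>, \<open>C\<close> means that \<open>d g - \<alpha> a\<close>, \<open>d g - \<beta> b\<close>,
\<open>d g - \<gamma> c\<close> are multiples of the unit vectors. Their sum is \<open>2 d g\<close>, so the multiples are twice the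
coordinates of \<open>d g\<close>, whence \<open>\<alpha> a = d (-x, y, z)\<close>, and similarly for \<open>b\<close> and \<open>c\<close>.\<close>

lemma anticevian_vertices_unique:
  assumes "\<not> xcollinear A' B' C'"
    and cev: "cevian_triangle (A', B', C') (pt (vector [x, y, z])) = ordinary_triangle A B C"
    and nz: "x \<noteq> 0" "y \<noteq> 0" "z \<noteq> 0"
  shows "A' = pt (vector [- x, y, z]) \<and> B' = pt (vector [x, - y, z]) \<and> C' = pt (vector [x, y, - z])"
proof -
  let ?g = "vector [x, y, z] :: real^3"
  obtain a where a: "a \<noteq> 0" "A' = pt a" by (rule pt_surj)
  obtain b where b: "b \<noteq> 0" "B' = pt b" by (rule pt_surj)
  obtain c where c: "c \<noteq> 0" "C' = pt c" by (rule pt_surj)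
  define d where "d = a \<bullet> (b \<times> c)"
  have d: "d \<noteq> 0" using assms(1) a b c by (simp add: xcollinear_pt d_def)
  have ba: "b \<bullet> (a \<times> c) \<noteq> 0"
    using d unfolding d_def by (simp add: vec3_simps algebra_simps)
  have cb: "c \<bullet> (a \<times> b) \<noteq> 0"
    using d unfolding d_def by (simp add: vec3_simps algebra_simps)
  have g: "?g \<noteq> 0" using nz by (simp add: vec3_eq_iff)
  have gABC: "pt ?g \<noteq> Ordinary A" "pt ?g \<noteq> Ordinary B" "pt ?g \<noteq> Ordinary C"
    unfolding vertices_pt using nz g by (simp_all add: pt_eq_iff vec3_simps)
  have m: "meet (join A' (pt ?g)) (join B' C') = Ordinary A"
      "meet (join B' (pt ?g)) (join A' C') = Ordinary B"
      "meet (join C' (pt ?g)) (join A' B') = Ordinary C"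
    using cev by (simp_all add: cevian_triangle_def ordinary_triangle_def)
  \<comment> \<open>Two distinct sides of a nondegenerate triangle meet in their common vertex.\<close>
  have at_vertex: "meet (join (pt u) (pt v)) (join (pt v) (pt w)) = pt v"
      "meet (join (pt u) (pt v)) (join (pt w) (pt v)) = pt v"
    if "u \<bullet> (v \<times> w) \<noteq> 0" for u v w
  proof -
    have nz': "u \<times> v \<noteq> 0" "v \<times> w \<noteq> 0" "w \<times> v \<noteq> 0" "v \<noteq> 0"
      using that cross_skew[of w v] cross_triple[of u v w] by (auto simp: inner_commute)
    have eq: "(u \<times> v) \<times> (v \<times> w) = (u \<bullet> (v \<times> w)) *\<^sub>R v"
      "(u \<times> v) \<times> (w \<times> v) = (- (u \<bullet> (v \<times> w))) *\<^sub>R v"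
      by (simp_all add: vec3_simps, algebra+)
    show "meet (join (pt u) (pt v)) (join (pt v) (pt w)) = pt v"
      "meet (join (pt u) (pt v)) (join (pt w) (pt v)) = pt v"
      using that nz' pt_scale by (simp_all add: join_pt meet_hline eq del: scaleR_minus_left)
  qed
  have ag: "a \<times> ?g \<noteq> 0"
  proof
    assume "a \<times> ?g = 0"
    then have "pt a = pt ?g" using a g by (simp add: pt_eq_iff)
    note eq = this[symmetric]
    then show False using m(2) at_vertex(1)[OF ba] gABC unfolding eq a(2) b(2) c(2) by simp
  qed
  have bg: "b \<times> ?g \<noteq> 0"
  proof
    assume "b \<times> ?g = 0"
    then have "pt b = pt ?g" using b g by (simp add: pt_eq_iff)
    note eq = this[symmetric]
    then show False using m(1) at_vertex(1)[of a b c] d gABC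
      unfolding eq a(2) b(2) c(2) d_def by simp
  qed
  have cg: "c \<times> ?g \<noteq> 0"
  proof
    assume "c \<times> ?g = 0"
    then have "pt c = pt ?g" using c g by (simp add: pt_eq_iff)
    note eq = this[symmetric]
    then show False using m(1) at_vertex(2)[of a c b] d gABC
      unfolding eq a(2) b(2) c(2) d_def cross_skew[of c b] by simp
  qed
  define \<alpha> \<beta> \<gamma> where "\<alpha> = ?g \<bullet> (b \<times> c)" and "\<beta> = ?g \<bullet> (c \<times> a)" and "\<gamma> = ?g \<bullet> (a \<times> b)"
  note D = cevian_triangle_pt[OF d_def d ag bg cg, folded \<alpha>_def \<beta>_def \<gamma>_def]
  have e: "pt (d *\<^sub>R ?g - \<alpha> *\<^sub>R a) = pt (vector [1, 0, 0])"
    "pt (d *\<^sub>R ?g - \<beta> *\<^sub>R b) = pt (vector [0, 1, 0])"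
    "pt (d *\<^sub>R ?g - \<gamma> *\<^sub>R c) = pt (vector [0, 0, 1])"
    using D(1) cev by (simp_all add: a b c ordinary_triangle_def vertices_pt)
  have e1: "vector [1, 0, 0] \<noteq> (0 :: real^3)" "vector [0, 1, 0] \<noteq> (0 :: real^3)"
    "vector [0, 0, 1] \<noteq> (0 :: real^3)" by (simp_all add: vec3_eq_iff)
  obtain l1 where l1: "d *\<^sub>R ?g - \<alpha> *\<^sub>R a = l1 *\<^sub>R vector [1, 0, 0]"
    using e(1)[symmetric] pt_eq_iff_scale[OF e1(1) D(2)] by auto
  obtain l2 where l2: "d *\<^sub>R ?g - \<beta> *\<^sub>R b = l2 *\<^sub>R vector [0, 1, 0]"
    using e(2)[symmetric] pt_eq_iff_scale[OF e1(2) D(3)] by auto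
  obtain l3 where l3: "d *\<^sub>R ?g - \<gamma> *\<^sub>R c = l3 *\<^sub>R vector [0, 0, 1]"
    using e(3)[symmetric] pt_eq_iff_scale[OF e1(3) D(4)] by auto
  have sum: "d *\<^sub>R ?g = \<alpha> *\<^sub>R a + \<beta> *\<^sub>R b + \<gamma> *\<^sub>R c"
    unfolding d_def \<alpha>_def \<beta>_def \<gamma>_def by (rule cramer3)
  have eqs: "\<alpha> *\<^sub>R a = d *\<^sub>R vector [- x, y, z]" "\<beta> *\<^sub>R b = d *\<^sub>R vector [x, - y, z]"
      "\<gamma> *\<^sub>R c = d *\<^sub>R vector [x, y, - z]"
    using l1 l2 l3 sum by (simp_all add: vec3_eq_iff)
  have nz': "vector [- x, y, z] \<noteq> (0 :: real^3)" "vector [x, - y, z] \<noteq> (0 :: real^3)"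
    "vector [x, y, - z] \<noteq> (0 :: real^3)" using nz by (simp_all add: vec3_eq_iff)
  have "\<alpha> \<noteq> 0" "\<beta> \<noteq> 0" "\<gamma> \<noteq> 0" using eqs nz' d by auto
  then have "pt a = pt (\<alpha> *\<^sub>R a)" "pt b = pt (\<beta> *\<^sub>R b)" "pt c = pt (\<gamma> *\<^sub>R c)"
    using a b c by (simp_all add: pt_scale)
  then show ?thesis unfolding eqs a b c using d nz' by (simp add: pt_scale)
qed

lemma anticevian_triangle_reference:
  assumes nz: "x \<noteq> 0" "y \<noteq> 0" "z \<noteq> 0"
  shows "anticevian_triangle (ordinary_triangle A B C) (pt (vector [x, y, z])) =
    (pt (vector [- x, y, z]), pt (vector [x, - y, z]), pt (vector [x, y, - z]))"
proof -
  let ?g = "vector [x, y, z] :: real^3"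
  let ?a = "vector [- x, y, z] :: real^3" and ?b = "vector [x, - y, z] :: real^3"
  let ?c = "vector [x, y, - z] :: real^3"
  define d where "d = 4 * x * y * z"
  have d: "d = ?a \<bullet> (?b \<times> ?c)" "d \<noteq> 0"
    using nz by (simp_all add: d_def vec3_simps algebra_simps)
  have ng: "?a \<times> ?g \<noteq> 0" "?b \<times> ?g \<noteq> 0" "?c \<times> ?g \<noteq> 0"
    using nz by (simp_all add: vec3_simps)
  have nz': "?a \<noteq> 0" "?b \<noteq> 0" "?c \<noteq> 0" using nz by (simp_all add: vec3_eq_iff)
  have e: "d *\<^sub>R ?g - (?g \<bullet> (?b \<times> ?c)) *\<^sub>R ?a = (2 * d * x) *\<^sub>R vector [1, 0, 0]"
    "d *\<^sub>R ?g - (?g \<bullet> (?c \<times> ?a)) *\<^sub>R ?b = (2 * d * y) *\<^sub>R vector [0, 1, 0]"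
    "d *\<^sub>R ?g - (?g \<bullet> (?a \<times> ?b)) *\<^sub>R ?c = (2 * d * z) *\<^sub>R vector [0, 0, 1]"
    by (simp_all add: d_def vec3_simps algebra_simps)
  have "vector [1, 0, 0] \<noteq> (0 :: real^3)" "vector [0, 1, 0] \<noteq> (0 :: real^3)"
    "vector [0, 0, 1] \<noteq> (0 :: real^3)" by (simp_all add: vec3_eq_iff)
  then have cev: "cevian_triangle (pt ?a, pt ?b, pt ?c) (pt ?g) = ordinary_triangle A B C"
    using cevian_triangle_pt(1)[OF d ng] d(2) nz unfolding e
    by (simp add: pt_scale ordinary_triangle_def vertices_pt)
  have "\<not> xcollinear (pt ?a) (pt ?b) (pt ?c)" using d nz' by (simp add: xcollinear_pt)
  then have "(case (pt ?a, pt ?b, pt ?c) of (A', B', C') \<Rightarrow> \<not> xcollinear A' B' C' \<and>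
      cevian_triangle (A', B', C') (pt ?g) = ordinary_triangle A B C)"
    using cev by simp
  then show ?thesis unfolding anticevian_triangle_def
  proof (rule the_equality)
    fix T assume "case T of (A', B', C') \<Rightarrow> \<not> xcollinear A' B' C' \<and>
      cevian_triangle (A', B', C') (pt ?g) = ordinary_triangle A B C"
    then show "T = (pt ?a, pt ?b, pt ?c)"
      using anticevian_vertices_unique[OF _ _ nz] by (cases T) blast
  qed
qed

lemma reflected_cevian_triangle_reference:
  assumes "x \<noteq> 0" "y \<noteq> 0" "z \<noteq> 0"
  shows "reflected_cevian_triangle A B C (pt (vector [x, y, z])) =
    (pt (vector [0, z, y]), pt (vector [z, 0, x]), pt (vector [y, x, 0]))"
proof -
  have r: "point_reflection (midpoint p q) = (\<lambda>u. - u + (p + q))" for p q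
    by (auto simp: point_reflection_def midpoint_def algebra_simps simp flip: scaleR_add_left)
  have n: "linear (\<lambda>u :: plane. - u)" by (simp add: linear_iff)
  note ext = extend_affine_pt[OF n]
  have "extend_affine (point_reflection (midpoint B C)) (pt (vector [0, y, z])) = pt (vector [0, z, y])"
    "extend_affine (point_reflection (midpoint A C)) (pt (vector [x, 0, z])) = pt (vector [z, 0, x])"
    "extend_affine (point_reflection (midpoint A B)) (pt (vector [x, y, 0])) = pt (vector [y, x, 0])"
    unfolding r using assms
    by (intro ext; simp add: vec3_eq_iff; simp add: algebra_simps)+
  then show ?thesis unfolding reflected_cevian_triangle_def
    by (simp add: cevian_triangle_reference assms)
qed

lemma isotomic_conjugate_reference:
  assumes "x \<noteq> 0" "y \<noteq> 0" "z \<noteq> 0"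
  shows "isotomic_conjugate A B C (pt (vector [x, y, z])) = pt (vector [y * z, z * x, x * y])"
proof -
  have j: "join (pt (vector [1, 0, 0])) (pt (vector [0, z, y])) = hline (vector [0, - y, z])"
    "join (pt (vector [0, 1, 0])) (pt (vector [z, 0, x])) = hline (vector [x, 0, - z])"
    "join (pt (vector [0, 0, 1])) (pt (vector [y, x, 0])) = hline (vector [- x, y, 0])"
    using assms by (intro join_pt_eq; simp add: vec3_simps)+
  show ?thesis
    unfolding isotomic_conjugate_def reflected_cevian_triangle_reference[OF assms]
      ordinary_triangle_def perspector_def split_conv vertices_pt j
    by (rule common_point_hline; use assms in \<open>simp add: vec3_simps\<close>)
qed

lemma extend_complement_map_pt:
  assumes "v \<noteq> 0" "vector [v$2 + v$3, v$3 + v$1, v$1 + v$2] \<noteq> (0 :: real^3)"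
  shows "extend_affine (complement_map A B C) (pt v) = pt (vector [v$2 + v$3, v$3 + v$1, v$1 + v$2])"
proof -
  have eq: "complement_map A B C = (\<lambda>u. (- 1 / 2) *\<^sub>R u + (1 / 2) *\<^sub>R (A + B + C))"
    by (rule ext) (simp add: complement_map_def centroid_def vec_eq_iff field_simps)
  have "extend_affine (complement_map A B C) (pt v) =
      pt ((1 / 2) *\<^sub>R vector [v$2 + v$3, v$3 + v$1, v$1 + v$2])"
    unfolding eq using assms
    by (intro extend_affine_pt)
      (simp_all add: linear_iff mass_def weighted_sum_def vec_eq_iff field_simps)
  then show ?thesis using assms by (simp add: pt_scale)
qed

section \<open>The point X in coordinates\<close>

lemma on_sides_reference:
  assumes "v \<noteq> 0"
  shows "on_sides (ordinary_triangle A B C) (pt v) \<longleftrightarrow> v$1 = 0 \<or> v$2 = 0 \<or> v$3 = 0"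
proof -
  have "join (Ordinary B) (Ordinary C) = hline (vector [1, 0, 0])"
    "join (Ordinary A) (Ordinary C) = hline (vector [0, - 1, 0])"
    "join (Ordinary A) (Ordinary B) = hline (vector [0, 0, 1])"
    unfolding vertices_pt by (intro join_pt_eq; simp add: vec3_simps)+
  then show ?thesis
    using assms by (simp add: on_sides_def ordinary_triangle_def pt_in_hline inner3)
qed

lemma on_sides_anticomplementary:
  assumes "v \<noteq> 0"
  shows "on_sides (anticomplementary_triangle A B C) (pt v) \<longleftrightarrow>
    v$2 + v$3 = 0 \<or> v$3 + v$1 = 0 \<or> v$1 + v$2 = 0"
proof -
  let ?K = "complement_map A B C"
  have inj: "inj ?K"
    by (rule injI) (simp add: complement_map_def)
  have "?K (B + C - A) = A" "?K (C + A - B) = B" "?K (A + B - C) = C"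
    by (simp_all add: complement_map_def centroid_def vec_eq_iff field_simps)
  then have K: "inv ?K A = B + C - A" "inv ?K B = C + A - B" "inv ?K C = A + B - C"
    using inj by (metis inv_f_f)+
  have p: "Ordinary (B + C - A) = pt (vector [- 1, 1, 1])"
    "Ordinary (C + A - B) = pt (vector [1, - 1, 1])"
    "Ordinary (A + B - C) = pt (vector [1, 1, - 1])"
    by (simp_all add: pt_def)
  have "join (Ordinary (C + A - B)) (Ordinary (A + B - C)) = hline (vector [0, 2, 2])"
    "join (Ordinary (B + C - A)) (Ordinary (A + B - C)) = hline (vector [- 2, 0, - 2])"
    "join (Ordinary (B + C - A)) (Ordinary (C + A - B)) = hline (vector [2, 2, 0])"
    unfolding p by (intro join_pt_eq; simp add: vec3_simps)+
  then show ?thesis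
    using assms by (simp add: on_sides_def anticomplementary_triangle_def ordinary_triangle_def
      K pt_in_hline inner3) argo
qed

lemma isotomcomplement_reference:
  assumes "x \<noteq> 0" "y \<noteq> 0" "z \<noteq> 0" "y + z \<noteq> 0" "z + x \<noteq> 0" "x + y \<noteq> 0"
  shows "isotomcomplement A B C (pt (vector [x, y, z])) =
    pt (vector [x * (y + z), y * (z + x), z * (x + y)])"
proof -
  have e: "vector [z * x + x * y, x * y + y * z, y * z + z * x] =
    (vector [x * (y + z), y * (z + x), z * (x + y)] :: real^3)"
    by (simp add: vec3_eq_iff algebra_simps)
  show ?thesis unfolding isotomcomplement_def isotomic_conjugate_reference[OF assms(1-3)]
    using assms by (subst extend_complement_map_pt) (simp_all add: e, simp_all add: vec3_eq_iff)
qed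

text \<open>The coordinates of the point \<open>X\<close> for \<open>P = (x : y : z)\<close>.\<close>

definition ceva_coords :: "real \<Rightarrow> real \<Rightarrow> real \<Rightarrow> real^3" where
  "ceva_coords x y z = vector [x\<^sup>2 * (y + z), y\<^sup>2 * (z + x), z\<^sup>2 * (x + y)]"

text \<open>Each vertex of the anticevian triangle of \<open>Q\<close>, in normalised coordinates, is the image of the
corresponding vertex of the cevian triangle of \<open>P\<close> under one and the same map \<open>u \<mapsto> k u + t X\<close>, with
\<open>X\<close> taken as a coordinate vector. The last equation says that this map preserves mass \<open>1\<close>, and it
decides between homothety and translation.\<close>

lemma anticevian_vertices_as_images:
  fixes x y z
  defines "k \<equiv> (x + y) * (y + z) * (z + x) / (2 * x * y * z)" and "t \<equiv> - 1 / (2 * x * y * z)"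
  assumes nz: "x \<noteq> 0" "y \<noteq> 0" "z \<noteq> 0" and sums: "y + z \<noteq> 0" "z + x \<noteq> 0" "x + y \<noteq> 0"
  shows "(1 / (2 * y * z)) *\<^sub>R vector [- (x * (y + z)), y * (z + x), z * (x + y)] =
      (k / (y + z)) *\<^sub>R vector [0, y, z] + t *\<^sub>R ceva_coords x y z"
    and "(1 / (2 * z * x)) *\<^sub>R vector [x * (y + z), - (y * (z + x)), z * (x + y)] =
      (k / (z + x)) *\<^sub>R vector [x, 0, z] + t *\<^sub>R ceva_coords x y z"
    and "(1 / (2 * x * y)) *\<^sub>R vector [x * (y + z), y * (z + x), - (z * (x + y))] =
      (k / (x + y)) *\<^sub>R vector [x, y, 0] + t *\<^sub>R ceva_coords x y z"
    and "k = 1 - t * mass (ceva_coords x y z)"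
proof -
  have k: "k / (y + z) = (x + y) * (z + x) / (2 * x * y * z)"
    "k / (z + x) = (x + y) * (y + z) / (2 * x * y * z)"
    "k / (x + y) = (y + z) * (z + x) / (2 * x * y * z)"
    using sums by (simp_all add: k_def)
  show "(1 / (2 * y * z)) *\<^sub>R vector [- (x * (y + z)), y * (z + x), z * (x + y)] =
      (k / (y + z)) *\<^sub>R vector [0, y, z] + t *\<^sub>R ceva_coords x y z"
    "(1 / (2 * z * x)) *\<^sub>R vector [x * (y + z), - (y * (z + x)), z * (x + y)] =
      (k / (z + x)) *\<^sub>R vector [x, 0, z] + t *\<^sub>R ceva_coords x y z"
    "(1 / (2 * x * y)) *\<^sub>R vector [x * (y + z), y * (z + x), - (z * (x + y))] =
      (k / (x + y)) *\<^sub>R vector [x, y, 0] + t *\<^sub>R ceva_coords x y z"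
    unfolding k t_def using nz
    by (simp_all add: ceva_coords_def vec3_eq_iff field_simps power2_eq_square)
  show "k = 1 - t * mass (ceva_coords x y z)"
    unfolding k_def t_def using nz
    by (simp add: ceva_coords_def field_simps power2_eq_square)
qed

text \<open>In the plane the map becomes \<open>u \<mapsto> k u + t m\<close>, where \<open>m\<close> is the weighted sum of the coordinates
of \<open>X\<close>. Since \<open>1 - k = t s\<close> with \<open>s\<close> the mass of \<open>X\<close>, it fixes \<open>X = m / s\<close> if \<open>s \<noteq> 0\<close>, and it is a
translation if \<open>s = 0\<close>.\<close>

lemma cevian_anticevian_homothetic_or_congruent:
  assumes nz: "x \<noteq> 0" "y \<noteq> 0" "z \<noteq> 0" and sums: "y + z \<noteq> 0" "z + x \<noteq> 0" "x + y \<noteq> 0"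
  defines "T \<equiv> cevian_triangle (ordinary_triangle A B C) (pt (vector [x, y, z]))"
    and "T' \<equiv> anticevian_triangle (ordinary_triangle A B C)
      (isotomcomplement A B C (pt (vector [x, y, z])))"
    and "X \<equiv> pt (ceva_coords x y z)"
  shows "X = Ordinary c \<Longrightarrow> homothetic_from c T T'"
    and "X = Infinite \<delta> \<Longrightarrow> congruent_triangles T T'"
proof -
  define k where "k = (x + y) * (y + z) * (z + x) / (2 * x * y * z)"
  define t where "t = - 1 / (2 * x * y * z)"
  define s where "s = mass (ceva_coords x y z)"
  define m where "m = weighted_sum (ceva_coords x y z)"
  note im = anticevian_vertices_as_images[OF nz sums, folded k_def t_def s_def]
  define p where "p = (1 / (y + z)) *\<^sub>R weighted_sum (vector [0, y, z])"
  define q where "q = (1 / (z + x)) *\<^sub>R weighted_sum (vector [x, 0, z])"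
  define r where "r = (1 / (x + y)) *\<^sub>R weighted_sum (vector [x, y, 0])"
  have T: "T = ordinary_triangle p q r"
    using nz sums unfolding T_def p_def q_def r_def
    by (simp add: cevian_triangle_reference) (simp add: pt_def ordinary_triangle_def add.commute)
  have vertices:
    "(1 / (2 * y * z)) *\<^sub>R weighted_sum (vector [- (x * (y + z)), y * (z + x), z * (x + y)]) =
      k *\<^sub>R p + t *\<^sub>R m"
    "(1 / (2 * z * x)) *\<^sub>R weighted_sum (vector [x * (y + z), - (y * (z + x)), z * (x + y)]) =
      k *\<^sub>R q + t *\<^sub>R m"
    "(1 / (2 * x * y)) *\<^sub>R weighted_sum (vector [x * (y + z), y * (z + x), - (z * (x + y))]) =
      k *\<^sub>R r + t *\<^sub>R m"
    using im(1-3)[THEN arg_cong[of _ _ weighted_sum]]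
    unfolding weighted_sum_simps(1,2) p_def q_def r_def m_def by simp_all
  have masses: "mass (vector [- (x * (y + z)), y * (z + x), z * (x + y)]) = 2 * y * z"
    "mass (vector [x * (y + z), - (y * (z + x)), z * (x + y)]) = 2 * z * x"
    "mass (vector [x * (y + z), y * (z + x), - (z * (x + y))]) = 2 * x * y"
    by (simp_all add: algebra_simps)
  have T': "T' = ordinary_triangle (k *\<^sub>R p + t *\<^sub>R m) (k *\<^sub>R q + t *\<^sub>R m) (k *\<^sub>R r + t *\<^sub>R m)"
    unfolding T'_def isotomcomplement_reference[OF nz sums]
    using nz sums vertices
    by (subst anticevian_triangle_reference)
      (simp_all add: pt_def masses ordinary_triangle_def del: mass_simps weighted_sum_simps)
  have k: "k \<noteq> 0" using nz sums by (simp add: k_def)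
  show "homothetic_from c T T'" if "X = Ordinary c"
  proof -
    have s: "s \<noteq> 0" "c = (1 / s) *\<^sub>R m" using that by (auto simp: X_def pt_def s_def m_def split: if_splits)
    have "1 - k = t * s" using im(4) by simp
    then have "homothety c k u = k *\<^sub>R u + t *\<^sub>R m" for u
    proof -
      have "homothety c k u = k *\<^sub>R u + (1 - k) *\<^sub>R c" by (simp add: homothety_def algebra_simps)
      also have "(1 - k) *\<^sub>R c = t *\<^sub>R m" unfolding \<open>1 - k = t * s\<close> using s by simp
      finally show ?thesis .
    qed
    then show ?thesis unfolding homothetic_from_def T T' using k by metis
  qed
  show "congruent_triangles T T'" if "X = Infinite \<delta>"
  proof -
    have "s = 0" using that by (auto simp: X_def pt_def s_def split: if_splits)
    then have "k = 1" using im(4) by simp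
    then show ?thesis unfolding congruent_triangles_def T T'
      by (intro exI[of _ p] exI[of _ q] exI[of _ r] exI[of _ "\<lambda>u. u + t *\<^sub>R m"]) simp
  qed
qed

text \<open>The lines through corresponding vertices have the normal vectors named below, all orthogonal
to the coordinates of \<open>X\<close>.\<close>

lemma ceva_conjugate_reference:
  assumes nz: "x \<noteq> 0" "y \<noteq> 0" "z \<noteq> 0" and sums: "y + z \<noteq> 0" "z + x \<noteq> 0" "x + y \<noteq> 0"
  shows "ceva_conjugate (ordinary_triangle A B C) (pt (vector [x, y, z]))
    (isotomcomplement A B C (pt (vector [x, y, z]))) = pt (ceva_coords x y z)"
proof -
  have anti: "anticevian_triangle (ordinary_triangle A B C)
      (pt (vector [x * (y + z), y * (z + x), z * (x + y)])) =
    (pt (vector [- (x * (y + z)), y * (z + x), z * (x + y)]),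
     pt (vector [x * (y + z), - (y * (z + x)), z * (x + y)]),
     pt (vector [x * (y + z), y * (z + x), - (z * (x + y))]))"
    using nz sums by (intro anticevian_triangle_reference) auto
  let ?l = "vector [y * z * (y - z), - (z * x * (y + z)), x * y * (y + z)] :: real^3"
  let ?m = "vector [y * z * (z + x), z * x * (z - x), - (x * y * (z + x))] :: real^3"
  let ?n = "vector [- (y * z * (x + y)), z * x * (x + y), x * y * (x - y)] :: real^3"
  have "?l \<noteq> 0" "?m \<noteq> 0" "?n \<noteq> 0" using nz sums by (simp_all add: vec3_eq_iff)
  then have joins:
    "join (pt (vector [0, y, z])) (pt (vector [- (x * (y + z)), y * (z + x), z * (x + y)])) = hline ?l"
    "join (pt (vector [x, 0, z])) (pt (vector [x * (y + z), - (y * (z + x)), z * (x + y)])) = hline ?m"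
    "join (pt (vector [x, y, 0])) (pt (vector [x * (y + z), y * (z + x), - (z * (x + y))])) = hline ?n"
    by (intro join_pt_eq; simp add: vec3_simps algebra_simps)+
  \<comment> \<open>One nonzero coordinate of the cross product suffices to see that the first two lines differ.\<close>
  have "(?l \<times> ?m)$3 = 2 * x * y * z ^ 3 * (x + y)"
    by (simp add: vec3_simps, algebra)
  then have lm: "?l \<times> ?m \<noteq> 0" using nz sums by auto
  show ?thesis
    unfolding ceva_conjugate_def isotomcomplement_reference[OF nz sums]
      cevian_triangle_reference[OF nz] anti perspector_def split_conv joins
  proof (rule common_point_hline[OF lm])
    show "ceva_coords x y z \<noteq> 0" using nz sums by (simp add: ceva_coords_def vec3_eq_iff)
  qed (simp_all add: ceva_coords_def inner3 algebra_simps power2_eq_square)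
qed

text \<open>The first three images are the points \<open>A\<^sub>3\<close>, \<open>B\<^sub>3\<close>, \<open>C\<^sub>3\<close>; the last two equations together are
the fixed point property of \<open>X\<close>. For the first three, the factor \<open>k\<close> is the product of the masses of
the two vertices of the cevian triangle that enter the image; for the others the masses cancel.\<close>

lemma triangle_map_images:
  assumes nz: "x \<noteq> 0" "y \<noteq> 0" "z \<noteq> 0" and sums: "y + z \<noteq> 0" "z + x \<noteq> 0" "x + y \<noteq> 0"
  defines "\<tau> \<equiv> triangle_map A B C (pt (vector [0, y, z]), pt (vector [x, 0, z]), pt (vector [x, y, 0]))"
    and "\<tau>' \<equiv> triangle_map A B C (pt (vector [0, z, y]), pt (vector [z, 0, x]), pt (vector [y, x, 0]))"
  shows "\<tau> (pt (vector [0, z, y])) =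
      pt (vector [z * x * (x + y) + x * y * (z + x), y\<^sup>2 * (z + x), z\<^sup>2 * (x + y)])"
    and "\<tau> (pt (vector [z, 0, x])) =
      pt (vector [x\<^sup>2 * (y + z), y * z * (x + y) + x * y * (y + z), z\<^sup>2 * (x + y)])"
    and "\<tau> (pt (vector [y, x, 0])) =
      pt (vector [x\<^sup>2 * (y + z), y\<^sup>2 * (z + x), y * z * (z + x) + z * x * (y + z)])"
    and "\<tau>' (pt (ceva_coords x y z)) =
      pt (vector [y * z * (y + z), z * x * (z + x), x * y * (x + y)])"
    and "\<tau> (pt (vector [y * z * (y + z), z * x * (z + x), x * y * (x + y)])) =
      pt (ceva_coords x y z)"
proof -
  show "\<tau> (pt (vector [0, z, y])) =
      pt (vector [z * x * (x + y) + x * y * (z + x), y\<^sup>2 * (z + x), z\<^sup>2 * (x + y)])"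
    unfolding \<tau>_def using nz sums
    by (intro triangle_map_pt[where k = "(z + x) * (x + y)" and \<alpha> = "0" and \<beta> = "z * (x + y)" and \<gamma> = "y * (z + x)"])
      (simp_all add: vec3_eq_iff, simp_all add: algebra_simps power2_eq_square)
  show "\<tau> (pt (vector [z, 0, x])) =
      pt (vector [x\<^sup>2 * (y + z), y * z * (x + y) + x * y * (y + z), z\<^sup>2 * (x + y)])"
    unfolding \<tau>_def using nz sums
    by (intro triangle_map_pt[where k = "(y + z) * (x + y)" and \<alpha> = "z * (x + y)" and \<beta> = "0" and \<gamma> = "x * (y + z)"])
      (simp_all add: vec3_eq_iff, simp_all add: algebra_simps power2_eq_square)
  show "\<tau> (pt (vector [y, x, 0])) =
      pt (vector [x\<^sup>2 * (y + z), y\<^sup>2 * (z + x), y * z * (z + x) + z * x * (y + z)])"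
    unfolding \<tau>_def using nz sums
    by (intro triangle_map_pt[where k = "(y + z) * (z + x)" and \<alpha> = "y * (z + x)" and \<beta> = "x * (y + z)" and \<gamma> = "0"])
      (simp_all add: vec3_eq_iff, simp_all add: algebra_simps power2_eq_square)
  show "\<tau>' (pt (ceva_coords x y z)) =
      pt (vector [y * z * (y + z), z * x * (z + x), x * y * (x + y)])"
    unfolding \<tau>'_def ceva_coords_def using nz sums
    by (intro triangle_map_pt[where k = "1" and \<alpha> = "x\<^sup>2" and \<beta> = "y\<^sup>2" and \<gamma> = "z\<^sup>2"])
      (simp_all add: vec3_eq_iff, simp_all add: algebra_simps power2_eq_square)
  show "\<tau> (pt (vector [y * z * (y + z), z * x * (z + x), x * y * (x + y)])) =
      pt (ceva_coords x y z)"
    unfolding \<tau>_def ceva_coords_def using nz sums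
    by (intro triangle_map_pt[where k = "1" and \<alpha> = "y * z" and \<beta> = "z * x" and \<gamma> = "x * y"])
      (simp_all add: vec3_eq_iff, simp_all add: algebra_simps power2_eq_square)
qed

lemma vertex_image_lines:
  assumes nz: "x \<noteq> 0" "y \<noteq> 0" "z \<noteq> 0" and sums: "y + z \<noteq> 0" "z + x \<noteq> 0" "x + y \<noteq> 0"
  defines "\<tau> \<equiv> triangle_map A B C (pt (vector [0, y, z]), pt (vector [x, 0, z]), pt (vector [x, y, 0]))"
  shows "meet (join (Ordinary A) (\<tau> (pt (vector [0, z, y])))) (join (Ordinary B) (\<tau> (pt (vector [z, 0, x]))))
      = pt (ceva_coords x y z)"
    and "pt (ceva_coords x y z) \<in> join (Ordinary C) (\<tau> (pt (vector [y, x, 0])))"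
proof -
  let ?l = "vector [0, - (z\<^sup>2 * (x + y)), y\<^sup>2 * (z + x)] :: real^3"
  let ?m = "vector [z\<^sup>2 * (x + y), 0, - (x\<^sup>2 * (y + z))] :: real^3"
  let ?n = "vector [- (y\<^sup>2 * (z + x)), x\<^sup>2 * (y + z), 0] :: real^3"
  have X: "ceva_coords x y z \<noteq> 0" using nz sums by (simp add: ceva_coords_def vec3_eq_iff)
  have joins: "join (Ordinary A) (\<tau> (pt (vector [0, z, y]))) = hline ?l"
    "join (Ordinary B) (\<tau> (pt (vector [z, 0, x]))) = hline ?m"
    "join (Ordinary C) (\<tau> (pt (vector [y, x, 0]))) = hline ?n"
    unfolding vertices_pt \<tau>_def triangle_map_images(1-3)[OF nz sums] using nz sums
    by (intro join_pt_eq; simp add: vec3_simps)+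
  have lm: "?l \<times> ?m = (z\<^sup>2 * (x + y)) *\<^sub>R ceva_coords x y z"
    by (simp add: ceva_coords_def vec3_simps)
  have "z\<^sup>2 * (x + y) \<noteq> 0" using nz sums by simp
  then show "meet (join (Ordinary A) (\<tau> (pt (vector [0, z, y])))) (join (Ordinary B) (\<tau> (pt (vector [z, 0, x]))))
      = pt (ceva_coords x y z)"
    unfolding joins using X meet_hline[of ?l ?m] unfolding lm by (simp add: pt_scale)
  show "pt (ceva_coords x y z) \<in> join (Ordinary C) (\<tau> (pt (vector [y, x, 0])))"
    unfolding joins pt_in_hline[OF X] by (simp add: ceva_coords_def inner3)
qed

end

theorem theorem3p9:
  fixes A B C :: plane and P :: xpoint
  assumes "\<not> collinear {A, B, C}"
    and "\<not> on_sides (ordinary_triangle A B C) P"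
    and "\<not> on_sides (anticomplementary_triangle A B C) P"
    and DEF: "(D, E, F) = cevian_triangle (ordinary_triangle A B C) P"
    and DEF3: "(D\<^sub>3, E\<^sub>3, F\<^sub>3) = reflected_cevian_triangle A B C P"
    and TP: "T\<^sub>P = triangle_map A B C (D, E, F)"
    and TP': "T\<^sub>P' = triangle_map A B C (D\<^sub>3, E\<^sub>3, F\<^sub>3)"
    and Q: "Q = isotomcomplement A B C P"
    and ABC3: "A\<^sub>3 = T\<^sub>P D\<^sub>3" "B\<^sub>3 = T\<^sub>P E\<^sub>3" "C\<^sub>3 = T\<^sub>P F\<^sub>3"
    and X: "X = meet (join (Ordinary A) A\<^sub>3) (join (Ordinary B) B\<^sub>3)"
  shows "X \<in> join (Ordinary C) C\<^sub>3 \<and>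
    (T\<^sub>P \<circ> T\<^sub>P') X = X \<and>
    X = ceva_conjugate (ordinary_triangle A B C) P Q \<and>
    (\<forall>x. X = Ordinary x \<longrightarrow>
       homothetic_from x (D, E, F) (anticevian_triangle (ordinary_triangle A B C) Q)) \<and>
    (\<forall>d. X = Infinite d \<longrightarrow>
       congruent_triangles (D, E, F) (anticevian_triangle (ordinary_triangle A B C) Q))"
proof -
  interpret reference_triangle A B C by unfold_locales (rule assms(1))
  obtain v where v: "v \<noteq> 0" "P = pt v" by (rule pt_surj)
  define x y z where "x = v$1" and "y = v$2" and "z = v$3"
  have vec_eq: "v = vector [x, y, z]" by (simp add: x_def y_def z_def vec3_eq_iff)
  have P: "P = pt (vector [x, y, z])"
    by (simp add: v(2) flip: vec_eq)
  have nz: "x \<noteq> 0" "y \<noteq> 0" "z \<noteq> 0"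
    using assms(2) v on_sides_reference by (simp_all add: x_def y_def z_def)
  have sums: "y + z \<noteq> 0" "z + x \<noteq> 0" "x + y \<noteq> 0"
    using assms(3) v on_sides_anticomplementary by (simp_all add: x_def y_def z_def)
  have D: "D = pt (vector [0, y, z])" "E = pt (vector [x, 0, z])" "F = pt (vector [x, y, 0])"
    using DEF by (simp_all add: P cevian_triangle_reference nz)
  have D3: "D\<^sub>3 = pt (vector [0, z, y])" "E\<^sub>3 = pt (vector [z, 0, x])" "F\<^sub>3 = pt (vector [y, x, 0])"
    using DEF3 by (simp_all add: P reflected_cevian_triangle_reference nz)
  have X': "X = pt (ceva_coords x y z)"
    unfolding X ABC3 TP D D3 by (rule vertex_image_lines(1)[OF nz sums])
  have "X \<in> join (Ordinary C) C\<^sub>3"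
    unfolding X' ABC3 TP D D3 by (rule vertex_image_lines(2)[OF nz sums])
  moreover have "(T\<^sub>P \<circ> T\<^sub>P') X = X"
    unfolding X' TP TP' D D3 using triangle_map_images(4,5)[OF nz sums] by simp
  moreover have "X = ceva_conjugate (ordinary_triangle A B C) P Q"
    unfolding X' Q P by (rule ceva_conjugate_reference[OF nz sums, symmetric])
  ultimately show ?thesis
    using cevian_anticevian_homothetic_or_congruent[OF nz sums] unfolding DEF Q P X' by blast
qed

end
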